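(* The mate construction is not invariant under equality of misère games: there exist games $G$ and $H$ with $G=H$ but $G^-\ne H^-$. Specifically, for $H = \{\{\{\{2\}\},\,0\}\}$ one has $H=0$, but $H^-\neq 1 = 0^-$.
   Context: A (misère impartial) game is a hereditarily finite set; its elements are called its options, and $G\cong H$ means $G$ and $H$ are identical as sets. $0=\{\}$, $1=\{0\}$, $2=\{0,1\}$. The sum is $G+H=\{G'+H: G'\in G\}\cup\{G+H':H'\in H\}$. Misère outcome: $G$ is a $\mathscr{P}$-position if $G$ is nonempty and every option of $G$ is an $\mathscr{N}$-position; otherwise $G$ is an $\mathscr{N}$-position. $G=H$ means that $G+X$ and $H+X$ have the same misère outcome for every game $X$. The mate $G^-$ of a game $G$ is defined recursively (on sets) by $G^-=1$ if $G\cong 0$, and $G^-=\{(G')^-:G'\in G\}$ otherwise. *)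

theory Defs
  imports Main "HOL-Library.FSet"
begin

text \<open>Finite sets are extensional, so this datatype is a model of the hereditarily finite sets,
  and HOL equality on it is the relation \<open>\<cong>\<close> (identity as sets).\<close>

datatype game = Game (opts: "game fset")

definition is_option :: "(game \<times> game) set" where
  "is_option = {(G', G). G' |\<in>| opts G}"

lemma wf_is_option: "wf is_option"
proof (rule wfUNIVI)
  fix P :: "game \<Rightarrow> bool" and x
  assume step: "\<forall>x. (\<forall>y. (y, x) \<in> is_option \<longrightarrow> P y) \<longrightarrow> P x"
  show "P x"
    by (induction x) (use step in \<open>auto simp: is_option_def\<close>)
qed

lemma is_option_Game [simp]: "(G', Game S) \<in> is_option \<longleftrightarrow> G' |\<in>| S"
  by (simp add: is_option_def)

definition zero_game :: game where "zero_game = Game {||}"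
definition one_game :: game where "one_game = Game {|zero_game|}"
definition two_game :: game where "two_game = Game {|zero_game, one_game|}"

function game_sum :: "game \<Rightarrow> game \<Rightarrow> game" where
  "game_sum (Game S) (Game T) =
     Game ((\<lambda>G'. game_sum G' (Game T)) |`| S |\<union>| (\<lambda>H'. game_sum (Game S) H') |`| T)"
  by pat_completeness auto
termination
  by (relation "is_option <*lex*> is_option") (auto simp: wf_is_option)

function P_position :: "game \<Rightarrow> bool" where
  "P_position (Game S) \<longleftrightarrow> S \<noteq> {||} \<and> (\<forall>G' |\<in>| S. \<not> P_position G')"
  by pat_completeness auto
termination
  by (relation is_option) (auto simp: wf_is_option)

abbreviation N_position :: "game \<Rightarrow> bool" where
  "N_position G \<equiv> \<not> P_position G"

text \<open>As every game is either a P- or an N-position, two games have the same outcome iff they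
  agree on being P-positions.\<close>

definition game_eq :: "game \<Rightarrow> game \<Rightarrow> bool" (infix "=\<^sub>m" 50) where
  "G =\<^sub>m H \<longleftrightarrow> (\<forall>X. P_position (game_sum G X) \<longleftrightarrow> P_position (game_sum H X))"

function mate :: "game \<Rightarrow> game" where
  "mate (Game S) = (if S = {||} then one_game else Game (mate |`| S))"
  by pat_completeness auto
termination
  by (relation is_option) (auto simp: wf_is_option)

end

theory Submission
  imports Defs
begin

text \<open>
  Write \<open>H = {K}\<close> with \<open>K = {{{2}}, 0}\<close>. A move from \<open>H\<close> to \<open>K\<close> can be answered at once
  by \<open>K \<rightarrow> 0\<close>, so inside any sum the component \<open>H\<close> never helps anybody; as \<open>H\<close> on its own is
  an \<open>\<N>\<close>-position, just like \<open>0\<close>, it equals \<open>0\<close> (lemma \<open>eq_zeroI\<close>).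

  The mate spoils that answer, because it replaces \<open>0\<close> by \<open>1\<close>: now \<open>K\<^sup>- = {A, 1}\<close>, where
  \<open>A = {{2\<^sup>-}}\<close>, and \<open>A\<close> has become a genuine alternative to the move to \<open>1\<close>.
  The game \<open>X = {2}\<close> detects this.
    \<^item> \<open>1 + {2}\<close> is an \<open>\<N>\<close>-position, since \<open>0 + {2} = {2}\<close> is a \<open>\<P>\<close>-position.
    \<^item> \<open>K\<^sup>- + 2\<close> is a \<open>\<P>\<close>-position. Indeed \<open>A + 1\<close> and \<open>1\<close> are \<open>\<P>\<close>-positions, and its
      options \<open>A + 2\<close> and \<open>K\<^sup>- + 1\<close> can both move to \<open>A + 1\<close>, its options \<open>1 + 2\<close> and
      \<open>K\<^sup>- + 0\<close> both to \<open>1\<close>.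
    \<^item> \<open>H\<^sup>- + {2}\<close> is therefore a \<open>\<P>\<close>-position: its option \<open>K\<^sup>- + {2}\<close> can move to
      \<open>K\<^sup>- + 2\<close>, and its option \<open>H\<^sup>- + 2\<close> can move to \<open>H\<^sup>- + 0 = H\<^sup>-\<close>, which is a \<open>\<P>\<close>-position
      because its only option \<open>K\<^sup>-\<close> moves to \<open>1\<close>.
\<close>

lemma P_position_iff:
  "P_position G \<longleftrightarrow> opts G \<noteq> {||} \<and> (\<forall>G' |\<in>| opts G. N_position G')"
  by (cases G) simp

lemma opts_game_sum:
  "opts (game_sum G X) =
    (\<lambda>G'. game_sum G' X) |`| opts G |\<union>| (\<lambda>X'. game_sum G X') |`| opts X"
  by (cases G; cases X) simp

lemma zero_game_sum: "game_sum zero_game X = X"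
proof (induction X)
  case (Game T)
  have "game_sum zero_game |`| T = T"
    using Game by (force simp: fset_eq_iff image_iff)
  then show ?case
    by (simp add: zero_game_def)
qed

lemma sum_zero_game: "game_sum G zero_game = G"
proof (induction G)
  case (Game S)
  have "(\<lambda>G'. game_sum G' zero_game) |`| S = S"
    using Game by (force simp: fset_eq_iff image_iff)
  then show ?case
    by (simp add: zero_game_def)
qed

text \<open>
  Whoever wins \<open>X\<close> also wins \<open>G + X\<close>: play as in \<open>X\<close>, and revert any opposing move in \<open>G\<close>.
  Reversion says nothing about who wins once \<open>X\<close> has run out, and under misere play the
  player to move wins \<open>0\<close>; hence the separate hypothesis that \<open>G\<close> is an \<open>\<N>\<close>-position.
\<close>

lemma eq_zeroI:
  assumes "N_position G"
    and reverses: "\<And>K. K |\<in>| opts G \<Longrightarrow> \<exists>L. L |\<in>| opts K \<and> L =\<^sub>m zero_game"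
  shows "G =\<^sub>m zero_game"
proof -
  have "P_position (game_sum G X) \<longleftrightarrow> P_position X" for X
  proof (induction X)
    case (Game T)
    show ?case
    proof (cases "T = {||}")
      case True
      then have "P_position (game_sum G (Game T)) \<longleftrightarrow> P_position G"
        by (simp add: sum_zero_game flip: zero_game_def)
      then show ?thesis using True assms(1) by simp
    next
      case False
      have "N_position (game_sum K (Game T))"
        if P: "P_position (Game T)" and K: "K |\<in>| opts G" for K
      proof -
        obtain L where "L |\<in>| opts K" "L =\<^sub>m zero_game"
          using reverses[OF K] by blast
        then have "game_sum L (Game T) |\<in>| opts (game_sum K (Game T))"
          and "P_position (game_sum L (Game T))"
          using P by (auto simp: opts_game_sum game_eq_def zero_game_sum)
        then show ?thesis
          using P_position_iff by blast
      qed
      with False Game show ?thesis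
        by (subst P_position_iff) (auto simp: opts_game_sum)
    qed
  qed
  then show ?thesis
    by (simp add: game_eq_def zero_game_sum)
qed

theorem mainTheorem5:
  fixes H :: game
  defines "H \<equiv> Game {| Game {| Game {| Game {| two_game |} |}, zero_game |} |}"
  shows "(\<exists>G K. G =\<^sub>m K \<and> \<not> mate G =\<^sub>m mate K)
    \<and> H =\<^sub>m zero_game \<and> \<not> mate H =\<^sub>m one_game \<and> mate zero_game = one_game"
proof -
  have mate_zero: "mate zero_game = one_game"
    by (simp add: zero_game_def)
  have H_zero: "H =\<^sub>m zero_game"
  proof (rule eq_zeroI)
    show "N_position H"
      by (simp add: H_def zero_game_def one_game_def two_game_def)
    have "zero_game =\<^sub>m zero_game"
      by (simp add: game_eq_def)
    then show "\<exists>L. L |\<in>| opts K \<and> L =\<^sub>m zero_game" if "K |\<in>| opts H" for K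
      using that by (auto simp: H_def)
  qed
  define X where "X = Game {|two_game|}"
  have "P_position (game_sum (mate H) X)"
    by (simp add: X_def H_def zero_game_def one_game_def two_game_def)
  moreover have "N_position (game_sum one_game X)"
    by (simp add: X_def zero_game_def one_game_def two_game_def)
  ultimately have "\<not> mate H =\<^sub>m one_game"
    unfolding game_eq_def by blast
  with mate_zero H_zero show ?thesis
    by metis
qed

end
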